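(* Let $f,x^*,M>0,G,\mathcal{D},\sigma^2,\varepsilon$ be as in the hypotheses below and $R=\|x^*-x^0\|$. Run Rennala SGD in the fixed computation model with times $0<\tau_1\le\dots\le\tau_n$, batch size $S=\max\{\lceil\sigma^2/M^2\rceil,1\}$ and stepsize $\gamma=\varepsilon/(M^2+\sigma^2/S)$, and assume $K:=2M^2R^2/\varepsilon^2$ is an integer. Then $x^0,\dots,x^K$ are computed within $$8\min_{m\in[n]}\left[\Big(\frac1m\sum_{i=1}^m\frac1{\tau_i}\Big)^{-1}\Big(\frac{M^2R^2}{\varepsilon^2}+\frac{\sigma^2R^2}{m\varepsilon^2}\Big)\right]$$ seconds, and $\mathbb{E}[f(\hat x^K)]-f(x^* )\le\varepsilon$ with $\hat x^K=\frac1K\sum_{k=0}^{K-1}x^k$.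
   Context: Hypotheses: $f:\mathbb{R}^d\to\mathbb{R}$ convex, minimized at $x^*$, $M$-Lipschitz; $\mathbb{E}_{\xi\sim\mathcal{D}}[G(x;\xi)]\in\partial f(x)$ and $\mathbb{E}\|G(x;\xi)-\mathbb{E}[G(x;\xi)]\|^2\le\sigma^2$ for all $x$. Rennala SGD in the fixed computation model: there are a server and $n$ workers; worker $i$ needs exactly $\tau_i$ seconds to compute one stochastic gradient $G(x;\xi)$ with a fresh independent $\xi\sim\mathcal{D}$; communication is instantaneous. At time $0$ every worker receives $(x^0,0)$ and starts computing. Each worker repeatedly: when it has received a pair $(x^k,k)$ it computes $G(x^k;\xi)$ (taking $\tau_i$ seconds), sends $(G(x^k;\xi),k)$ to the server, immediately receives back a pair, and starts computing at the received point. The server runs iterations $k=0,1,\dots,K-1$: it sets $g^k=0$ and an acceptance counter to $0$; whenever a pair $(g,k')$ arrives from a worker, if $k'=k$ it adds $g/S$ to $g^k$ and increments the counter, otherwise it discards $g$; in either case it then sends the current pair $(x^k,k)$ back to that worker; as soon as $S$ gradients have been accepted it sets $x^{k+1}=x^k-\gamma g^k$ and starts iteration $k+1$. *)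

theory Defs
  imports "HOL-Probability.Probability"
begin

definition subdifferential :: "('a::euclidean_space \<Rightarrow> real) \<Rightarrow> 'a \<Rightarrow> 'a set" where
  "subdifferential f x = {g. \<forall>y. f y \<ge> f x + g \<bullet> (y - x)}"

text \<open>Fixed computation model: worker i (i < n) finishes its j-th computation
  (j = 0,1,2,...) at time (j+1) * tau i. Event (i,j) consumes the fresh sample omega (i,j).\<close>
definition ev_time :: "(nat \<Rightarrow> real) \<Rightarrow> nat \<times> nat \<Rightarrow> real" where
  "ev_time \<tau> ij = (real (snd ij) + 1) * \<tau> (fst ij)"

text \<open>Admissible processing orders of the arrivals at the server: an enumeration of all
  arrival events that is non-decreasing in time (simultaneous arrivals processed in any order).\<close>
definition admissible_order :: "nat \<Rightarrow> (nat \<Rightarrow> real) \<Rightarrow> (nat \<Rightarrow> nat \<times> nat) \<Rightarrow> bool" where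
  "admissible_order n \<tau> e \<longleftrightarrow> bij_betw e UNIV ({..<n} \<times> UNIV) \<and> mono (\<lambda>p. ev_time \<tau> (e p))"

text \<open>Server state: current iteration k, acceptance counter, accumulated g^k,
  iterates computed so far, and for each worker the index of the point it is computing at.\<close>
record 'a rstate =
  rk :: nat
  racc :: nat
  rg :: 'a
  rxs :: "nat \<Rightarrow> 'a"
  rasg :: "nat \<Rightarrow> nat"

definition rennala_step ::
  "('a::real_vector \<Rightarrow> 'b \<Rightarrow> 'a) \<Rightarrow> nat \<Rightarrow> real \<Rightarrow> 'b \<Rightarrow> nat \<Rightarrow> 'a rstate \<Rightarrow> 'a rstate" where
  "rennala_step G S \<gamma> \<xi> i st =
    (let k = rk st;
         st1 = (if rasg st i = k
                then st\<lparr>racc := racc st + 1, rg := rg st + (1 / real S) *\<^sub>R G (rxs st k) \<xi>\<rparr>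
                else st);
         st2 = st1\<lparr>rasg := (rasg st1)(i := k)\<rparr>
     in if racc st2 = S
        then st2\<lparr>rk := k + 1, racc := 0, rg := 0,
                 rxs := (rxs st2)(k + 1 := rxs st2 k - \<gamma> *\<^sub>R rg st2)\<rparr>
        else st2)"

primrec rennala_run ::
  "('a::real_vector \<Rightarrow> 'b \<Rightarrow> 'a) \<Rightarrow> nat \<Rightarrow> real \<Rightarrow> 'a \<Rightarrow> (nat \<Rightarrow> nat \<times> nat)
    \<Rightarrow> (nat \<times> nat \<Rightarrow> 'b) \<Rightarrow> nat \<Rightarrow> 'a rstate" where
  "rennala_run G S \<gamma> x0 e \<omega> 0 =
     \<lparr>rk = 0, racc = 0, rg = 0, rxs = (\<lambda>_. x0), rasg = (\<lambda>_. 0)\<rparr>"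
| "rennala_run G S \<gamma> x0 e \<omega> (Suc p) =
     rennala_step G S \<gamma> (\<omega> (e p)) (fst (e p)) (rennala_run G S \<gamma> x0 e \<omega> p)"

definition rennala_iter ::
  "('a::real_vector \<Rightarrow> 'b \<Rightarrow> 'a) \<Rightarrow> nat \<Rightarrow> real \<Rightarrow> 'a \<Rightarrow> (nat \<Rightarrow> nat \<times> nat)
    \<Rightarrow> (nat \<times> nat \<Rightarrow> 'b) \<Rightarrow> nat \<Rightarrow> 'a" where
  "rennala_iter G S \<gamma> x0 e \<omega> k =
     rxs (rennala_run G S \<gamma> x0 e \<omega> (LEAST p. k \<le> rk (rennala_run G S \<gamma> x0 e \<omega> p))) k"

end

theory Submission
  imports Defs
begin

text \<open>
  Time: if an iteration is still running after a window of length \<open>t\<close>, then each worker \<open>i\<close> has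
  delivered more than \<open>t / \<tau> i - 1\<close> gradients in that window and at most the first of them was
  stale. Summing over the \<open>m\<close> fastest workers, an iteration ends as soon as
  \<open>t * (\<Sum>i<m. 1 / \<tau> i) \<ge> S + 2 m\<close>, in particular for
  \<open>t = 4 (m + \<sigma>\<^sup>2 / M\<^sup>2) / (\<Sum>i<m. 1 / \<tau> i)\<close>, and \<open>K\<close> such windows make up the stated bound.

  Error: which arrivals are accepted depends only on the arrival order, not on the samples, so every
  accepted sample is independent of the state at its arrival and one can argue one arrival at a time.
  The expected Lyapunov function (squared distance of the predicted next iterate from the minimizer
  plus \<open>2 \<gamma>\<close> times the accumulated suboptimality) grows by at most \<open>\<gamma>\<^sup>2 \<sigma>\<^sup>2 / S\<^sup>2\<close> per
  accepted gradient and by \<open>\<gamma>\<^sup>2 M\<^sup>2\<close> per iteration.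
  It is bounded as a nonnegative Lebesgue integral, so that integrability never has to be assumed.
\<close>

subsection \<open>Server state\<close>

lemma rk_step_cases:
  "rk (rennala_step G S \<gamma> \<xi> i st) = rk st \<or> rk (rennala_step G S \<gamma> \<xi> i st) = rk st + 1"
  by (simp add: rennala_step_def Let_def)

lemma rasg_step: "rasg (rennala_step G S \<gamma> \<xi> i st) = (rasg st)(i := rk st)"
  by (simp add: rennala_step_def Let_def)

lemma racc_step_same_iteration:
  assumes "rk (rennala_step G S \<gamma> \<xi> i st) = rk st"
  shows "racc (rennala_step G S \<gamma> \<xi> i st) = racc st + (if rasg st i = rk st then 1 else 0)"
  using assms by (auto simp: rennala_step_def Let_def split: if_splits)

lemma racc_step_less:
  assumes "S > 0" "racc st < S"
  shows "racc (rennala_step G S \<gamma> \<xi> i st) < S"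
  using assms by (auto simp: rennala_step_def Let_def)

lemma rxs_step_stable:
  "j \<le> rk st \<Longrightarrow> rxs (rennala_step G S \<gamma> \<xi> i st) j = rxs st j"
  by (auto simp: rennala_step_def Let_def)

lemma racc_run_less: "S > 0 \<Longrightarrow> racc (rennala_run G S \<gamma> x0 e \<omega> p) < S"
  by (induction p) (simp_all add: racc_step_less)

lemma rk_run_mono: "mono (\<lambda>p. rk (rennala_run G S \<gamma> x0 e \<omega> p))"
proof (rule incseq_SucI)
  show "rk (rennala_run G S \<gamma> x0 e \<omega> p) \<le> rk (rennala_run G S \<gamma> x0 e \<omega> (Suc p))" for p
    using rk_step_cases[of G S \<gamma> "\<omega> (e p)" "fst (e p)" "rennala_run G S \<gamma> x0 e \<omega> p"] by auto
qed

text \<open>A step writes only the entry after the current index, so an iterate is final once it is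
  reached. This makes the particular position chosen by \<open>LEAST\<close> in
  \<open>rennala_iter\<close> immaterial.\<close>

lemma rxs_run_stable:
  assumes "p \<le> q" "j \<le> rk (rennala_run G S \<gamma> x0 e \<omega> p)"
  shows "rxs (rennala_run G S \<gamma> x0 e \<omega> q) j = rxs (rennala_run G S \<gamma> x0 e \<omega> p) j"
  using assms(1)
proof (induction q rule: dec_induct)
  case (step q)
  have "j \<le> rk (rennala_run G S \<gamma> x0 e \<omega> q)"
    using assms(2) monoD[OF rk_run_mono step(1)] by (rule order_trans)
  with step show ?case by (simp add: rxs_step_stable)
qed simp

lemma rennala_iter_eq:
  assumes "k \<le> rk (rennala_run G S \<gamma> x0 e \<omega> p)"
  shows "rennala_iter G S \<gamma> x0 e \<omega> k = rxs (rennala_run G S \<gamma> x0 e \<omega> p) k"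
  unfolding rennala_iter_def
  by (rule rxs_run_stable[symmetric])
    (use assms in \<open>auto intro: Least_le LeastI[of "\<lambda>p. k \<le> rk (rennala_run G S \<gamma> x0 e \<omega> p)"]\<close>)

text \<open>The branches of \<open>rennala_step\<close> test indices and the counter only; samples
  enter \<open>rg\<close> and \<open>rxs\<close> alone.\<close>

lemma control_run_sample_independent:
  "rk (rennala_run G S \<gamma> x0 e \<omega> p) = rk (rennala_run G S \<gamma> x0 e \<omega>' p) \<and>
   racc (rennala_run G S \<gamma> x0 e \<omega> p) = racc (rennala_run G S \<gamma> x0 e \<omega>' p) \<and>
   rasg (rennala_run G S \<gamma> x0 e \<omega> p) = rasg (rennala_run G S \<gamma> x0 e \<omega>' p)"
  by (induction p) (auto simp: rennala_step_def Let_def)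

lemma rennala_run_cong:
  "(\<And>q. q < p \<Longrightarrow> \<omega> (e q) = \<omega>' (e q)) \<Longrightarrow>
    rennala_run G S \<gamma> x0 e \<omega> p = rennala_run G S \<gamma> x0 e \<omega>' p"
  by (induction p) auto

text \<open>The iteration index starts at 0 and grows by at most one per arrival, so it skips no
  value.\<close>

lemma exists_run_at_iteration:
  assumes "k \<le> rk (rennala_run G S \<gamma> x0 e \<omega> p)"
  shows "\<exists>q. rk (rennala_run G S \<gamma> x0 e \<omega> q) = k"
  using assms
proof (induction p)
  case 0
  then show ?case by (intro exI[of _ 0]) simp
next
  case (Suc p)
  show ?case
  proof (cases "k \<le> rk (rennala_run G S \<gamma> x0 e \<omega> p)")
    case False
    with Suc.prems show ?thesis
      using rk_step_cases[of G S \<gamma> "\<omega> (e p)" "fst (e p)" "rennala_run G S \<gamma> x0 e \<omega> p"]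
      by (intro exI[of _ "Suc p"]) auto
  qed (use Suc.IH in blast)
qed

subsection \<open>Running time\<close>

text \<open>Within one iteration only the first arrival of each worker can be stale.\<close>

lemma accepted_ge_arrivals:
  fixes e :: "nat \<Rightarrow> nat \<times> nat"
  assumes "rk (rennala_run G S \<gamma> x0 e \<omega> p) = k" "p \<le> q" "rk (rennala_run G S \<gamma> x0 e \<omega> q) = k"
  defines "N \<equiv> \<lambda>q i. card {r \<in> {p..<q}. fst (e r) = i}"
  shows "(\<forall>i. N q i > 0 \<longrightarrow> rasg (rennala_run G S \<gamma> x0 e \<omega> q) i = k) \<and>
         (\<Sum>i<m. N q i - 1) \<le> racc (rennala_run G S \<gamma> x0 e \<omega> q)"
  using assms(2,3)
proof (induction q rule: dec_induct)
  case base
  have "{r \<in> {p..<p}. fst (e r) = i} = {}" for i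
    by auto
  then show ?case by (simp only: N_def) simp
next
  case (step q)
  let ?st = "rennala_run G S \<gamma> x0 e \<omega> q"
  define i0 where "i0 = fst (e q)"
  have rkq: "rk ?st = k"
    using monoD[OF rk_run_mono, of p q G S \<gamma> x0 e \<omega>] monoD[OF rk_run_mono, of q "Suc q" G S \<gamma> x0 e \<omega>]
      step assms(1) by simp
  with step have IH: "\<And>i. N q i > 0 \<Longrightarrow> rasg ?st i = k" "(\<Sum>i<m. N q i - 1) \<le> racc ?st"
    by auto
  have N_Suc: "N (Suc q) i = N q i + (if i = i0 then 1 else 0)" for i
  proof -
    have "{r \<in> {p..<Suc q}. fst (e r) = i} =
      (if i = i0 then insert q {r \<in> {p..<q}. fst (e r) = i} else {r \<in> {p..<q}. fst (e r) = i})"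
      using step(1) by (auto simp: i0_def less_Suc_eq)
    then show ?thesis by (simp add: N_def)
  qed
  have racc: "racc (rennala_run G S \<gamma> x0 e \<omega> (Suc q)) = racc ?st + (if rasg ?st i0 = k then 1 else 0)"
    using racc_step_same_iteration[of G S \<gamma> "\<omega> (e q)" i0 ?st] step.prems rkq by (simp add: i0_def)
  \<comment> \<open>Truncated subtraction drops the first arrival of each worker. A later arrival of
    \<open>i0\<close> raises the sum by one, but by the first conjunct of the induction hypothesis
    it was computed at the current point, so the counter rises too.\<close>
  have "(\<Sum>i<m. N (Suc q) i - 1) \<le> (\<Sum>i<m. (N q i - 1) + (if i = i0 then (if N q i0 > 0 then 1 else 0) else 0))"
    by (intro sum_mono) (auto simp: N_Suc)
  also have "\<dots> \<le> (\<Sum>i<m. N q i - 1) + (if N q i0 > 0 then 1 else 0)"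
    by (simp add: sum.distrib)
  also have "\<dots> \<le> racc (rennala_run G S \<gamma> x0 e \<omega> (Suc q))"
    unfolding racc using IH by auto
  finally show ?case
    using IH(1) rkq by (auto simp: rasg_step N_Suc i0_def)
qed

lemma arrivals_in_window:
  fixes e :: "nat \<Rightarrow> nat \<times> nat"
  assumes "admissible_order n \<tau> e" "i < n" "\<tau> i > 0" "T \<ge> 0" "t \<ge> 0"
    and before: "\<And>q. q < p \<Longrightarrow> ev_time \<tau> (e q) \<le> T"
    and after: "\<And>q. ev_time \<tau> (e q) \<le> T + t \<Longrightarrow> q < p'"
  shows "t / \<tau> i - 1 \<le> real (card {r \<in> {p..<p'}. fst (e r) = i})"
proof -
  \<comment> \<open>Since event \<open>(i, j)\<close> occurs at \<open>(j + 1) * \<tau> i\<close>,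
    these are the \<open>j\<close> whose event falls after \<open>T\<close> and no later than
    \<open>T + t\<close>. The two floors together lose less than one, hence the \<open>- 1\<close>
    in the claim.\<close>
  define B where "B = {nat \<lfloor>T / \<tau> i\<rfloor>..<nat \<lfloor>(T + t) / \<tau> i\<rfloor>}"
  have "B \<subseteq> (\<lambda>r. snd (e r)) ` {r \<in> {p..<p'}. fst (e r) = i}"
  proof
    fix j assume j: "j \<in> B"
    have "(i, j) \<in> range e"
      using assms(1,2) by (simp add: admissible_order_def bij_betw_def)
    then obtain r where r: "e r = (i, j)" by (metis imageE)
    have "T / \<tau> i < real j + 1"
      using j by (simp add: B_def) linarith
    then have "T < ev_time \<tau> (e r)"
      using assms(3) by (simp add: r ev_time_def field_simps)
    then have "p \<le> r"
      using before[of r] by (meson not_le)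
    moreover have "real j + 1 \<le> (T + t) / \<tau> i"
      using j by (simp add: B_def) linarith
    then have "ev_time \<tau> (e r) \<le> T + t"
      using assms(3) by (simp add: r ev_time_def field_simps)
    then have "r < p'" by (rule after)
    ultimately show "j \<in> (\<lambda>r. snd (e r)) ` {r \<in> {p..<p'}. fst (e r) = i}"
      using r by (intro image_eqI[of _ _ r]) auto
  qed
  then have "card B \<le> card {r \<in> {p..<p'}. fst (e r) = i}"
    by (intro surj_card_le) auto
  moreover have "t / \<tau> i - 1 \<le> real (card B)"
  proof -
    have "T / \<tau> i \<ge> 0" "(T + t) / \<tau> i = T / \<tau> i + t / \<tau> i" "t / \<tau> i \<ge> 0"
      using assms by (auto simp: add_divide_distrib)
    then show ?thesis
      unfolding B_def card_atLeastLessThan by linarith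
  qed
  ultimately show ?thesis by linarith
qed

text \<open>Event times are monotone along \<open>e\<close>, so the arrivals up to time
  \<open>T\<close> form an initial segment. It is not everything, because worker 0 alone delivers
  after any given time; \<open>p\<close> is the first position beyond \<open>T\<close>.\<close>

lemma admissible_order_prefix:
  assumes "admissible_order n \<tau> e" "\<forall>i<n. 0 < \<tau> i"
  obtains p where "\<And>q. ev_time \<tau> (e q) \<le> T \<longleftrightarrow> q < p"
proof -
  have inj: "inj e" and rng: "range e = {..<n} \<times> UNIV" and mono: "mono (\<lambda>p. ev_time \<tau> (e p))"
    using assms(1) by (auto simp: admissible_order_def bij_betw_def)
  have "n > 0"
    using rng by (cases n) auto
  obtain j where j: "real j * \<tau> 0 > T"
    using assms(2) \<open>n > 0\<close> reals_Archimedean3 by blast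
  have "(0, j) \<in> range e" using rng \<open>n > 0\<close> by auto
  then obtain q where "e q = (0, j)" by (metis imageE)
  with j assms(2) \<open>n > 0\<close> have q: "\<not> ev_time \<tau> (e q) \<le> T"
    by (auto simp: ev_time_def algebra_simps not_le intro: less_trans)
  show ?thesis
  proof (rule that)
    show "ev_time \<tau> (e r) \<le> T \<longleftrightarrow> r < (LEAST q. \<not> ev_time \<tau> (e q) \<le> T)" for r
    proof
      assume "ev_time \<tau> (e r) \<le> T"
      then show "r < (LEAST q. \<not> ev_time \<tau> (e q) \<le> T)"
        using LeastI[of "\<lambda>q. \<not> ev_time \<tau> (e q) \<le> T" q, OF q] monoD[OF mono, of "LEAST q. \<not> ev_time \<tau> (e q) \<le> T" r]
        by (meson leI order_trans)
    qed (use not_less_Least in blast)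
  qed
qed

text \<open>The \<open>2 * m\<close> pays for two gradients per worker: one lost to rounding in the
  window and one that may be stale. If iteration \<open>k\<close> outlived the window, the counter
  would reach \<open>S\<close>, contradicting \<open>racc_run_less\<close>.\<close>

lemma iteration_time:
  assumes adm: "admissible_order n \<tau> e" and tpos: "\<forall>i<n. 0 < \<tau> i"
    and "S > 0" "1 \<le> m" "m \<le> n" "T \<ge> 0"
    and t: "real S + 2 * real m \<le> t * (\<Sum>i<m. 1 / \<tau> i)"
    and rk: "k \<le> rk (rennala_run G S \<gamma> x0 e \<omega> p)"
    and before: "\<And>q. q < p \<Longrightarrow> ev_time \<tau> (e q) \<le> T"
  shows "\<exists>p'. Suc k \<le> rk (rennala_run G S \<gamma> x0 e \<omega> p') \<and> (\<forall>q<p'. ev_time \<tau> (e q) \<le> T + t)"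
proof -
  let ?run = "rennala_run G S \<gamma> x0 e \<omega>"
  have "t \<ge> 0"
  proof (rule ccontr)
    assume "\<not> t \<ge> 0"
    moreover have "(\<Sum>i<m. 1 / \<tau> i) \<ge> 0"
      using tpos \<open>m \<le> n\<close> by (intro sum_nonneg) (auto intro: less_imp_le)
    ultimately have "t * (\<Sum>i<m. 1 / \<tau> i) \<le> 0"
      by (simp add: mult_nonpos_nonneg)
    with t \<open>S > 0\<close> show False by simp
  qed
  obtain p' where p': "\<And>q. ev_time \<tau> (e q) \<le> T + t \<longleftrightarrow> q < p'"
    using admissible_order_prefix[OF adm tpos] by blast
  have "p \<le> p'"
    using before p' \<open>t \<ge> 0\<close> by (meson add_increasing2 le_less_linear less_irrefl order_refl)
  have "Suc k \<le> rk (?run p')"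
  proof (rule ccontr)
    assume "\<not> Suc k \<le> rk (?run p')"
    then have "rk (?run p) = k" "rk (?run p') = k"
      using rk monoD[OF rk_run_mono \<open>p \<le> p'\<close>, of G S \<gamma> x0 e \<omega>] by auto
    then have "(\<Sum>i<m. card {r \<in> {p..<p'}. fst (e r) = i} - 1) \<le> racc (?run p')"
      using accepted_ge_arrivals[OF _ \<open>p \<le> p'\<close>] by blast
    with racc_run_less[OF \<open>S > 0\<close>, of G \<gamma> x0 e \<omega> p']
    have "real (\<Sum>i<m. card {r \<in> {p..<p'}. fst (e r) = i} - 1) < real S"
      by linarith
    moreover have "(\<Sum>i<m. t / \<tau> i - 2) \<le> real (\<Sum>i<m. card {r \<in> {p..<p'}. fst (e r) = i} - 1)"
      unfolding of_nat_sum
    proof (rule sum_mono)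
      fix i assume "i \<in> {..<m}"
      then have "t / \<tau> i - 1 \<le> real (card {r \<in> {p..<p'}. fst (e r) = i})"
        using tpos \<open>m \<le> n\<close> p' before \<open>T \<ge> 0\<close> \<open>t \<ge> 0\<close> by (intro arrivals_in_window[OF adm]) auto
      then show "t / \<tau> i - 2 \<le> real (card {r \<in> {p..<p'}. fst (e r) = i} - 1)"
        by linarith
    qed
    moreover have "(\<Sum>i<m. t / \<tau> i - 2) = t * (\<Sum>i<m. 1 / \<tau> i) - 2 * real m"
      by (simp add: sum_subtractf sum_distrib_left)
    ultimately show False using t by linarith
  qed
  with p' show ?thesis by blast
qed

text \<open>Windows of length \<open>t\<close> are laid end to end. An iteration may end before its
  window does; \<open>iteration_time\<close> tolerates this by asking only for
  \<open>k \<le> rk\<close> at the start.\<close>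

lemma iterations_time:
  assumes adm: "admissible_order n \<tau> e" and tpos: "\<forall>i<n. 0 < \<tau> i"
    and "S > 0" "1 \<le> m" "m \<le> n" "t \<ge> 0"
    and t: "real S + 2 * real m \<le> t * (\<Sum>i<m. 1 / \<tau> i)"
  shows "\<exists>p. k \<le> rk (rennala_run G S \<gamma> x0 e \<omega> p) \<and> (\<forall>q<p. ev_time \<tau> (e q) \<le> real k * t)"
proof (induction k)
  case (Suc k)
  then obtain p where "k \<le> rk (rennala_run G S \<gamma> x0 e \<omega> p)" "\<And>q. q < p \<Longrightarrow> ev_time \<tau> (e q) \<le> real k * t"
    by blast
  from iteration_time[OF adm tpos assms(3-5) _ t this] \<open>t \<ge> 0\<close>
  show ?case by (simp add: algebra_simps)
qed (auto intro: exI[of _ 0])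


subsection \<open>Expected suboptimality\<close>

text \<open>Overwriting one coordinate by an independent fresh draw preserves the product law;
  Fubini then separates the draw. This serves as conditioning on all the other samples.\<close>

lemma nn_integral_PiM_resample:
  assumes "prob_space D" and F: "F \<in> borel_measurable (PiM UNIV (\<lambda>_. D))"
  shows "(\<integral>\<^sup>+\<omega>. F \<omega> \<partial>PiM UNIV (\<lambda>_. D)) = (\<integral>\<^sup>+\<omega>. \<integral>\<^sup>+\<xi>. F (fun_upd \<omega> i \<xi>) \<partial>D \<partial>PiM UNIV (\<lambda>_. D))"
proof -
  interpret D: prob_space D by fact
  interpret P: prob_space "PiM UNIV (\<lambda>_. D)" by (intro prob_space_PiM \<open>prob_space D\<close>)
  interpret pair_sigma_finite D "PiM UNIV (\<lambda>_. D)" ..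
  have upd: "(\<lambda>(\<xi>, \<omega>). fun_upd \<omega> i \<xi>) \<in> D \<Otimes>\<^sub>M PiM UNIV (\<lambda>_. D) \<rightarrow>\<^sub>M PiM UNIV (\<lambda>_. D)"
    unfolding case_prod_beta' by (rule measurable_fun_upd[where J=UNIV]) auto
  \<comment> \<open>The library fact is used with index set \<open>UNIV\<close>, which already
    contains \<open>i\<close>, so the update replaces a coordinate instead of adding one.\<close>
  have "(\<integral>\<^sup>+\<omega>. F \<omega> \<partial>PiM UNIV (\<lambda>_. D)) =
      (\<integral>\<^sup>+\<omega>. F \<omega> \<partial>distr (D \<Otimes>\<^sub>M PiM UNIV (\<lambda>_. D)) (PiM UNIV (\<lambda>_. D)) (\<lambda>(\<xi>, \<omega>). fun_upd \<omega> i \<xi>))"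
    using distr_pair_PiM_eq_PiM[of UNIV "\<lambda>_. D" i] \<open>prob_space D\<close> by simp
  also have "\<dots> = (\<integral>\<^sup>+z. F (case z of (\<xi>, \<omega>) \<Rightarrow> fun_upd \<omega> i \<xi>) \<partial>(D \<Otimes>\<^sub>M PiM UNIV (\<lambda>_. D)))"
    by (subst nn_integral_distr) (use upd F in simp_all)
  also have "\<dots> = (\<integral>\<^sup>+\<omega>. \<integral>\<^sup>+\<xi>. F (fun_upd \<omega> i \<xi>) \<partial>D \<partial>PiM UNIV (\<lambda>_. D))"
    using nn_integral_snd[OF measurable_compose[OF upd F]] by simp
  finally show ?thesis .
qed

text \<open>In the expanded square the cross term integrates to zero because the noise is centred.
  The constant \<open>b\<close> will carry the part of the Lyapunov bound that does not depend on
  the incoming sample.\<close>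

lemma nn_integral_centered_noise_le:
  fixes Z :: "'b \<Rightarrow> 'a::euclidean_space"
  assumes "prob_space D" and Z: "integrable D Z"
    and var: "integrable D (\<lambda>\<xi>. (norm (Z \<xi> - (\<integral>\<zeta>. Z \<zeta> \<partial>D)))\<^sup>2)"
      "(\<integral>\<xi>. (norm (Z \<xi> - (\<integral>\<zeta>. Z \<zeta> \<partial>D)))\<^sup>2 \<partial>D) \<le> s"
    and "b \<ge> 0"
  shows "(\<integral>\<^sup>+\<xi>. ennreal ((norm (a - c *\<^sub>R (Z \<xi> - (\<integral>\<zeta>. Z \<zeta> \<partial>D))))\<^sup>2 + b) \<partial>D)
    \<le> ennreal ((norm a)\<^sup>2 + b + c\<^sup>2 * s)"
proof -
  interpret prob_space D by fact
  define W where "W \<xi> = Z \<xi> - (\<integral>\<zeta>. Z \<zeta> \<partial>D)" for \<xi>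
  have W: "integrable D W" "(\<integral>\<xi>. W \<xi> \<partial>D) = 0"
    using Z by (simp_all add: W_def[abs_def] prob_space)
  have eq: "(norm (a - c *\<^sub>R W \<xi>))\<^sup>2 + b = (norm a)\<^sup>2 + b - 2 * c * (a \<bullet> W \<xi>) + c\<^sup>2 * (norm (W \<xi>))\<^sup>2" for \<xi>
    unfolding power2_norm_eq_inner
    by (simp add: inner_diff inner_commute algebra_simps power2_eq_square)
  have int: "integrable D (\<lambda>\<xi>. a \<bullet> W \<xi>)" "integrable D (\<lambda>\<xi>. (norm (W \<xi>))\<^sup>2)"
    using W(1) var(1) unfolding W_def[symmetric] by auto
  have "(\<integral>\<xi>. a \<bullet> W \<xi> \<partial>D) = 0"
    using W by simp
  then have "(\<integral>\<xi>. (norm (a - c *\<^sub>R W \<xi>))\<^sup>2 + b \<partial>D) = (norm a)\<^sup>2 + b + c\<^sup>2 * (\<integral>\<xi>. (norm (W \<xi>))\<^sup>2 \<partial>D)"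
    unfolding eq using int by (simp add: prob_space)
  also have "\<dots> \<le> (norm a)\<^sup>2 + b + c\<^sup>2 * s"
    using var(2) by (intro add_left_mono mult_left_mono) (auto simp: W_def)
  finally have le: "(\<integral>\<xi>. (norm (a - c *\<^sub>R W \<xi>))\<^sup>2 + b \<partial>D) \<le> (norm a)\<^sup>2 + b + c\<^sup>2 * s" .
  have "integrable D (\<lambda>\<xi>. (norm (a - c *\<^sub>R W \<xi>))\<^sup>2 + b)"
    unfolding eq using int by simp
  then have "(\<integral>\<^sup>+\<xi>. ennreal ((norm (a - c *\<^sub>R W \<xi>))\<^sup>2 + b) \<partial>D) = ennreal (\<integral>\<xi>. (norm (a - c *\<^sub>R W \<xi>))\<^sup>2 + b \<partial>D)"
    using \<open>b \<ge> 0\<close> by (intro nn_integral_eq_integral) auto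
  with le show ?thesis
    by (simp add: W_def ennreal_leI)
qed

text \<open>Testing the subgradient inequality at \<open>x + g\<close> bounds
  \<open>norm g * norm g\<close> by an increase of \<open>f\<close>, hence by
  \<open>M * norm g\<close>.\<close>

lemma norm_subgradient_le_lipschitz:
  fixes f :: "'a::euclidean_space \<Rightarrow> real"
  assumes "M-lipschitz_on UNIV f" "g \<in> subdifferential f x"
  shows "norm g \<le> M"
proof (cases "g = 0")
  case True
  then show ?thesis using lipschitz_on_nonneg[OF assms(1)] by simp
next
  case False
  have "norm g * norm g = g \<bullet> ((x + g) - x)"
    by (simp add: norm_eq_sqrt_inner)
  also have "\<dots> \<le> f (x + g) - f x"
    using assms(2) by (simp add: subdifferential_def) (metis add.commute add_diff_cancel_left' le_diff_eq)
  also have "\<dots> \<le> M * norm g"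
    using lipschitz_onD[OF assms(1), of "x + g" x] by (simp add: dist_norm)
  finally show ?thesis
    using False by simp
qed

section \<open>Deterministic control flow and measurability of the run\<close>

locale rennala_sgd = prob_space D
  for D :: "'b measure" +
  fixes f :: "'a::euclidean_space \<Rightarrow> real"
    and xstar x0 :: 'a
    and M \<sigma> \<gamma> :: real
    and G :: "'a \<Rightarrow> 'b \<Rightarrow> 'a"
    and e :: "nat \<Rightarrow> nat \<times> nat"
    and S :: nat
  assumes min: "\<And>x. f xstar \<le> f x"
    and lip: "M-lipschitz_on UNIV f"
    and Gmeas: "(\<lambda>(x, \<xi>). G x \<xi>) \<in> borel_measurable (borel \<Otimes>\<^sub>M D)"
    and Gint: "\<And>x. integrable D (G x)"
    and Gunb: "\<And>x. (\<integral>\<xi>. G x \<xi> \<partial>D) \<in> subdifferential f x"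
    and Gvar_int: "\<And>x. integrable D (\<lambda>\<xi>. (norm (G x \<xi> - (\<integral>\<zeta>. G x \<zeta> \<partial>D)))\<^sup>2)"
    and Gvar: "\<And>x. (\<integral>\<xi>. (norm (G x \<xi> - (\<integral>\<zeta>. G x \<zeta> \<partial>D)))\<^sup>2 \<partial>D) \<le> \<sigma>\<^sup>2"
    and inj_e: "inj e"
    and S_pos: "S > 0"
    and \<gamma>_nonneg: "\<gamma> \<ge> 0"
begin

abbreviation "samples \<equiv> PiM (UNIV :: (nat \<times> nat) set) (\<lambda>_. D)"

abbreviation "run \<equiv> rennala_run G S \<gamma> x0 e"

definition "mean_grad x = (\<integral>\<xi>. G x \<xi> \<partial>D)"

text \<open>The control part of the state is deterministic, so it can be read off at any sample.\<close>

definition "iteration p = rk (run (\<lambda>_. undefined) p)"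

definition "accepted p = racc (run (\<lambda>_. undefined) p)"

definition "accepts p \<longleftrightarrow> rasg (run (\<lambda>_. undefined) p) (fst (e p)) = iteration p"

lemma rk_run: "rk (run \<omega> p) = iteration p"
  and racc_run: "racc (run \<omega> p) = accepted p"
  and rasg_run: "rasg (run \<omega> p) (fst (e p)) = iteration p \<longleftrightarrow> accepts p"
  using control_run_sample_independent[of G S \<gamma> x0 e \<omega> p "\<lambda>_. undefined"]
  by (auto simp: iteration_def accepted_def accepts_def)

lemma accepted_less: "accepted p < S"
  unfolding accepted_def by (rule racc_run_less[OF S_pos])

text \<open>The server tests the counter after a rejected gradient as well; by
  \<open>accepted_less\<close> that test fails, so only an acceptance can end an iteration.\<close>

lemma iteration_Suc:
  "iteration (Suc p) = (if accepts p \<and> Suc (accepted p) = S then Suc (iteration p) else iteration p)"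
  using accepted_less[of p] racc_run[of undefined p] rasg_run[of undefined p] rk_run[of undefined p]
  by (auto simp: rk_run[symmetric, of "Suc p" undefined] rennala_step_def Let_def)

lemma accepted_Suc:
  "accepted (Suc p) = (if accepts p then if Suc (accepted p) = S then 0 else Suc (accepted p) else accepted p)"
  using accepted_less[of p] racc_run[of undefined p] rasg_run[of undefined p] rk_run[of undefined p]
  by (auto simp: racc_run[symmetric, of "Suc p" undefined] rennala_step_def Let_def)

lemma rg_run_Suc:
  "rg (run \<omega> (Suc p)) =
    (if accepts p then if Suc (accepted p) = S then 0
       else rg (run \<omega> p) + (1 / real S) *\<^sub>R G (rxs (run \<omega> p) (iteration p)) (\<omega> (e p))
     else rg (run \<omega> p))"
  using accepted_less[of p] by (auto simp: rennala_step_def Let_def rk_run racc_run rasg_run)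

lemma rxs_run_Suc:
  "rxs (run \<omega> (Suc p)) j =
    (if accepts p \<and> Suc (accepted p) = S \<and> j = Suc (iteration p)
     then rxs (run \<omega> p) (iteration p) -
       \<gamma> *\<^sub>R (rg (run \<omega> p) + (1 / real S) *\<^sub>R G (rxs (run \<omega> p) (iteration p)) (\<omega> (e p)))
     else rxs (run \<omega> p) j)"
  using accepted_less[of p] by (auto simp: rennala_step_def Let_def rk_run racc_run rasg_run)

text \<open>The state before arrival \<open>p\<close> has read only the samples at
  \<open>e q\<close> with \<open>q < p\<close>, all different from \<open>e p\<close> by
  injectivity. This is the independence of the incoming sample from the state.\<close>

lemma run_resample: "run (fun_upd \<omega> (e p) \<xi>) p = run \<omega> p"
  by (rule rennala_run_cong) (use inj_e in \<open>auto dest: injD\<close>)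

lemma measurable_sampled_gradient:
  assumes "X \<in> borel_measurable samples"
  shows "(\<lambda>\<omega>. G (X \<omega>) (\<omega> i)) \<in> borel_measurable samples"
proof -
  have "(\<lambda>\<omega>. (X \<omega>, \<omega> i)) \<in> samples \<rightarrow>\<^sub>M borel \<Otimes>\<^sub>M D"
    using assms by measurable
  from measurable_compose[OF this Gmeas] show ?thesis by simp
qed

text \<open>The induction is joint because \<open>rg\<close> and \<open>rxs\<close> are updated from
  each other. All case distinctions in the step equations are deterministic.\<close>

lemma measurable_run:
  "(\<lambda>\<omega>. rg (run \<omega> p)) \<in> borel_measurable samples \<and>
   (\<forall>j. (\<lambda>\<omega>. rxs (run \<omega> p) j) \<in> borel_measurable samples)"
proof (induction p)
  case (Suc p)
  then have [measurable]: "(\<lambda>\<omega>. rg (run \<omega> p)) \<in> borel_measurable samples"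
    "\<And>j. (\<lambda>\<omega>. rxs (run \<omega> p) j) \<in> borel_measurable samples"
    by auto
  have [measurable]: "(\<lambda>\<omega>. G (rxs (run \<omega> p) (iteration p)) (\<omega> (e p))) \<in> borel_measurable samples"
    by (rule measurable_sampled_gradient) measurable
  show ?case
    unfolding rg_run_Suc rxs_run_Suc by (intro conjI allI) measurable
qed auto

lemmas measurable_rg = measurable_run[THEN conjunct1, measurable]
lemmas measurable_rxs = measurable_run[THEN conjunct2, rule_format, measurable]

lemma measurable_mean_grad [measurable]: "mean_grad \<in> borel_measurable borel"
  unfolding mean_grad_def[abs_def]
  by (rule borel_measurable_lebesgue_integral) (rule Gmeas)

lemma measurable_objective [measurable]: "f \<in> borel_measurable borel"
  by (intro borel_measurable_continuous_onI lipschitz_on_continuous_on[OF lip])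

section \<open>Growth of the Lyapunov function\<close>

lemma mean_grad_norm_le: "norm (mean_grad x) \<le> M"
  unfolding mean_grad_def by (rule norm_subgradient_le_lipschitz[OF lip Gunb])

lemma mean_grad_subgradient: "f x - f xstar \<le> mean_grad x \<bullet> (x - xstar)"
  using Gunb[of x] unfolding mean_grad_def subdifferential_def
  by (auto simp: inner_diff_right dest!: spec[of _ xstar])

text \<open>The classical estimate for one exact subgradient step: expand the square, bound the
  cross term by the subgradient inequality at \<open>xstar\<close> and the last term by the
  Lipschitz constant.\<close>

lemma mean_grad_step:
  "(norm (x - xstar - \<gamma> *\<^sub>R mean_grad x))\<^sup>2 + 2 * \<gamma> * (f x - f xstar) \<le> (norm (x - xstar))\<^sup>2 + \<gamma>\<^sup>2 * M\<^sup>2"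
proof -
  have "(norm (x - xstar - \<gamma> *\<^sub>R mean_grad x))\<^sup>2 =
      (norm (x - xstar))\<^sup>2 - 2 * \<gamma> * (mean_grad x \<bullet> (x - xstar)) + \<gamma>\<^sup>2 * (norm (mean_grad x))\<^sup>2"
    unfolding power2_norm_eq_inner
    by (simp add: inner_diff inner_commute algebra_simps power2_eq_square)
  moreover have "\<gamma> * (f x - f xstar) \<le> \<gamma> * (mean_grad x \<bullet> (x - xstar))"
    by (intro mult_left_mono mean_grad_subgradient \<gamma>_nonneg)
  moreover have "\<gamma>\<^sup>2 * (norm (mean_grad x))\<^sup>2 \<le> \<gamma>\<^sup>2 * M\<^sup>2"
    by (intro mult_left_mono power_mono mean_grad_norm_le) auto
  ultimately show ?thesis by linarith
qed

text \<open>The position, relative to the minimizer, that the current iteration would reach if its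
  missing gradients were all equal to their mean; its noise is a martingale within the iteration.\<close>

definition "predicted st =
  (let x = rxs st (rk st) in
     x - xstar - \<gamma> *\<^sub>R (rg st + (1 - real (racc st) / real S) *\<^sub>R mean_grad x))"

text \<open>The unfinished iteration is included, because \<open>predicted\<close> already
  anticipates its whole mean step.\<close>

definition "total_gap st = (\<Sum>j\<le>rk st. f (rxs st j) - f xstar)"

definition "lyapunov st = (norm (predicted st))\<^sup>2 + 2 * \<gamma> * total_gap st"

lemma total_gap_nonneg: "total_gap st \<ge> 0"
  unfolding total_gap_def by (intro sum_nonneg) (simp add: min)

lemma lyapunov_run_Suc_rejected:
  assumes "\<not> accepts p"
  shows "lyapunov (run \<omega> (Suc p)) = lyapunov (run \<omega> p)"
  unfolding lyapunov_def predicted_def total_gap_def rk_run racc_run rg_run_Suc rxs_run_Suc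
    iteration_Suc accepted_Suc
  using assms by simp

text \<open>Acceptance replaces one mean share \<open>1 / S\<close> in \<open>predicted\<close> by
  the actual sample and so shifts it by scaled noise. On the last acceptance of a batch the shifted
  vector is the new iterate relative to \<open>xstar\<close>; anticipating the next mean step and
  charging its gap then costs \<open>\<gamma>^2 * M^2\<close> by
  \<open>mean_grad_step\<close>.\<close>

lemma lyapunov_run_Suc_accepted:
  assumes "accepts p"
  defines "x \<equiv> \<lambda>\<omega>. rxs (run \<omega> p) (iteration p)"
  shows "lyapunov (run \<omega> (Suc p)) \<le>
    (norm (predicted (run \<omega> p) - (\<gamma> / real S) *\<^sub>R (G (x \<omega>) (\<omega> (e p)) - mean_grad (x \<omega>))))\<^sup>2
    + (2 * \<gamma> * total_gap (run \<omega> p) + (if Suc (accepted p) = S then \<gamma>\<^sup>2 * M\<^sup>2 else 0))"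
proof (cases "Suc (accepted p) = S")
  case True
  define x' where "x' = x \<omega> - \<gamma> *\<^sub>R (rg (run \<omega> p) + (1 / real S) *\<^sub>R G (x \<omega>) (\<omega> (e p)))"
  have x': "x' - xstar = predicted (run \<omega> p) - (\<gamma> / real S) *\<^sub>R (G (x \<omega>) (\<omega> (e p)) - mean_grad (x \<omega>))"
  proof -
    have "real (accepted p) = real S - 1"
      using True by linarith
    then have frac: "1 - real (accepted p) / real S = 1 / real S"
      using S_pos by (simp add: field_simps)
    show ?thesis
      unfolding predicted_def Let_def rk_run racc_run frac x'_def x_def by (simp add: algebra_simps)
  qed
  have "total_gap (run \<omega> (Suc p)) = (\<Sum>j\<le>Suc (iteration p). f (rxs (run \<omega> (Suc p)) j) - f xstar)"
    using assms True by (simp add: total_gap_def rk_run iteration_Suc del: rennala_run.simps)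
  also have "\<dots> = total_gap (run \<omega> p) + (f x' - f xstar)"
    using assms True
    by (simp add: total_gap_def rk_run rxs_run_Suc x'_def x_def del: rennala_run.simps)
  finally have gap: "total_gap (run \<omega> (Suc p)) = total_gap (run \<omega> p) + (f x' - f xstar)" .
  have "predicted (run \<omega> (Suc p)) = x' - xstar - \<gamma> *\<^sub>R mean_grad x'"
    using assms True
    by (simp add: predicted_def Let_def rk_run racc_run rg_run_Suc rxs_run_Suc iteration_Suc
        accepted_Suc x'_def x_def del: rennala_run.simps)
  with gap mean_grad_step[of x'] True show ?thesis
    by (simp add: lyapunov_def flip: x' del: rennala_run.simps) (simp add: algebra_simps)
next
  case False
  have "predicted (run \<omega> (Suc p)) =
      predicted (run \<omega> p) - (\<gamma> / real S) *\<^sub>R (G (x \<omega>) (\<omega> (e p)) - mean_grad (x \<omega>))"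
    using assms False
    by (simp add: predicted_def Let_def rk_run racc_run rg_run_Suc rxs_run_Suc iteration_Suc
        accepted_Suc x_def algebra_simps add_divide_distrib del: rennala_run.simps)
  moreover have "total_gap (run \<omega> (Suc p)) = total_gap (run \<omega> p)"
    using assms False
    by (simp add: total_gap_def rk_run rxs_run_Suc iteration_Suc del: rennala_run.simps)
  ultimately show ?thesis
    using False by (simp add: lyapunov_def del: rennala_run.simps)
qed

lemma measurable_predicted [measurable]: "(\<lambda>\<omega>. predicted (run \<omega> p)) \<in> borel_measurable samples"
  unfolding predicted_def Let_def rk_run racc_run by measurable

lemma measurable_total_gap [measurable]: "(\<lambda>\<omega>. total_gap (run \<omega> p)) \<in> borel_measurable samples"
  unfolding total_gap_def rk_run by measurable

lemma nn_integral_lyapunov_run_Suc_accepted: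
  assumes "accepts p"
  defines "r \<equiv> (if Suc (accepted p) = S then \<gamma>\<^sup>2 * M\<^sup>2 else 0) + (\<gamma> / real S)\<^sup>2 * \<sigma>\<^sup>2"
  shows "(\<integral>\<^sup>+\<omega>. lyapunov (run \<omega> (Suc p)) \<partial>samples) \<le> (\<integral>\<^sup>+\<omega>. lyapunov (run \<omega> p) \<partial>samples) + ennreal r"
proof -
  interpret P: prob_space samples
    by (intro prob_space_PiM prob_space_axioms)
  define x where "x \<omega> = rxs (run \<omega> p) (iteration p)" for \<omega>
  define b where "b \<omega> = 2 * \<gamma> * total_gap (run \<omega> p) + (if Suc (accepted p) = S then \<gamma>\<^sup>2 * M\<^sup>2 else 0)" for \<omega>
  \<comment> \<open>The incoming sample is made a separate argument so that it can be
    redrawn.\<close>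
  define h where "h \<omega> \<xi> = (norm (predicted (run \<omega> p) - (\<gamma> / real S) *\<^sub>R (G (x \<omega>) \<xi> - mean_grad (x \<omega>))))\<^sup>2 + b \<omega>"
    for \<omega> \<xi>
  have [measurable]: "x \<in> borel_measurable samples"
    unfolding x_def[abs_def] by measurable
  have [measurable]: "(\<lambda>\<omega>. G (x \<omega>) (\<omega> (e p))) \<in> borel_measurable samples"
    by (rule measurable_sampled_gradient) measurable
  have h_meas: "(\<lambda>\<omega>. ennreal (h \<omega> (\<omega> (e p)))) \<in> borel_measurable samples"
    unfolding h_def b_def by measurable
  have b_nonneg: "b \<omega> \<ge> 0" for \<omega>
    unfolding b_def using \<gamma>_nonneg total_gap_nonneg
    by (intro add_nonneg_nonneg mult_nonneg_nonneg) auto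
  have "(\<integral>\<^sup>+\<omega>. lyapunov (run \<omega> (Suc p)) \<partial>samples) \<le> (\<integral>\<^sup>+\<omega>. h \<omega> (\<omega> (e p)) \<partial>samples)"
    using lyapunov_run_Suc_accepted[OF assms(1)]
    by (intro nn_integral_mono ennreal_leI) (simp add: h_def b_def x_def del: rennala_run.simps)
  \<comment> \<open>By \<open>run_resample\<close>, redrawing coordinate \<open>e p\<close> leaves
    the state unchanged, so only the second argument of \<open>h\<close> becomes the fresh
    draw.\<close>
  also have "\<dots> = (\<integral>\<^sup>+\<omega>. \<integral>\<^sup>+\<xi>. h \<omega> \<xi> \<partial>D \<partial>samples)"
    using nn_integral_PiM_resample[OF prob_space_axioms h_meas, of "e p"]
    by (simp add: h_def b_def x_def run_resample)
  also have "\<dots> \<le> (\<integral>\<^sup>+\<omega>. ennreal (lyapunov (run \<omega> p)) + ennreal r \<partial>samples)"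
  proof (rule nn_integral_mono)
    fix \<omega>
    have "(\<integral>\<^sup>+\<xi>. h \<omega> \<xi> \<partial>D) \<le> ennreal ((norm (predicted (run \<omega> p)))\<^sup>2 + b \<omega> + (\<gamma> / real S)\<^sup>2 * \<sigma>\<^sup>2)"
      unfolding h_def mean_grad_def
      by (intro nn_integral_centered_noise_le prob_space_axioms Gint Gvar_int Gvar b_nonneg)
    also have "\<dots> = ennreal (lyapunov (run \<omega> p) + r)"
      by (simp add: lyapunov_def b_def r_def algebra_simps)
    also have "\<dots> = ennreal (lyapunov (run \<omega> p)) + ennreal r"
      by (intro ennreal_plus) (auto simp: lyapunov_def r_def \<gamma>_nonneg total_gap_nonneg)
    finally show "(\<integral>\<^sup>+\<xi>. h \<omega> \<xi> \<partial>D) \<le> ennreal (lyapunov (run \<omega> p)) + ennreal r" .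
  qed
  also have "\<dots> = (\<integral>\<^sup>+\<omega>. lyapunov (run \<omega> p) \<partial>samples) + ennreal r"
    by (subst nn_integral_add) (auto simp: lyapunov_def P.emeasure_space_1)
  finally show ?thesis .
qed

text \<open>The initial squared distance plus all increments so far. The \<open>+ 1\<close> is the
  mean step anticipated at the start, and the last factor multiplies the number of gradients
  accepted up to \<open>p\<close>.\<close>

definition "budget p = (norm (xstar - x0))\<^sup>2 + (real (iteration p) + 1) * (\<gamma>\<^sup>2 * M\<^sup>2) +
  (real (iteration p) * real S + real (accepted p)) * ((\<gamma> / real S)\<^sup>2 * \<sigma>\<^sup>2)"

lemma nn_integral_lyapunov_run_le:
  "(\<integral>\<^sup>+\<omega>. lyapunov (run \<omega> p) \<partial>samples) \<le> ennreal (budget p)"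
proof (induction p)
  case 0
  interpret P: prob_space samples
    by (intro prob_space_PiM prob_space_axioms)
  have "lyapunov (run \<omega> 0) \<le> budget 0" for \<omega>
    using mean_grad_step[of x0]
    by (simp add: lyapunov_def predicted_def Let_def total_gap_def budget_def iteration_def
        accepted_def norm_minus_commute)
  then have "(\<integral>\<^sup>+\<omega>. lyapunov (run \<omega> 0) \<partial>samples) \<le> (\<integral>\<^sup>+\<omega>. budget 0 \<partial>samples)"
    by (intro nn_integral_mono ennreal_leI)
  then show ?case by (simp add: P.emeasure_space_1)
next
  case (Suc p)
  show ?case
  proof (cases "accepts p")
    case True
    define r where "r = (if Suc (accepted p) = S then \<gamma>\<^sup>2 * M\<^sup>2 else 0) + (\<gamma> / real S)\<^sup>2 * \<sigma>\<^sup>2"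
    have "(\<integral>\<^sup>+\<omega>. lyapunov (run \<omega> (Suc p)) \<partial>samples) \<le> ennreal (budget p) + ennreal r"
      unfolding r_def
      by (rule order_trans[OF nn_integral_lyapunov_run_Suc_accepted[OF True]])
        (intro add_right_mono Suc.IH)
    also have "\<dots> = ennreal (budget p + r)"
      by (intro ennreal_plus[symmetric]) (auto simp: budget_def r_def)
    also have "budget p + r = budget (Suc p)"
    proof (cases "Suc (accepted p) = S")
      case S: True
      \<comment> \<open>The counter drops to 0 while the iteration index grows; as \<open>S\<close>
        is the old counter plus one, the noise part still grows by exactly one
        \<open>Q\<close>.\<close>
      define Q where "Q = (\<gamma> / real S)\<^sup>2 * \<sigma>\<^sup>2"
      have "real S = real (accepted p) + 1"
        using S by linarith
      then have "real S * Q = real (accepted p) * Q + Q"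
        by (metis distrib_right mult_1)
      with True S show ?thesis
        unfolding budget_def r_def iteration_Suc accepted_Suc Q_def[symmetric]
        by (simp add: algebra_simps)
    next
      case False
      with True show ?thesis
        by (simp add: budget_def r_def iteration_Suc accepted_Suc algebra_simps)
    qed
    finally show ?thesis .
  next
    case False
    with Suc.IH show ?thesis
      by (simp add: lyapunov_run_Suc_rejected budget_def iteration_Suc accepted_Suc
          del: rennala_run.simps)
  qed
qed

text \<open>At a position inside iteration \<open>K - 1\<close> all averaged iterates exist. By
  Jensen the gap of their average is at most \<open>total_gap / K\<close>, hence at most the
  Lyapunov function divided by \<open>2 * \<gamma> * K\<close>.\<close>

lemma expected_gap_average_le:
  assumes conv: "convex_on UNIV f" and K: "Suc (iteration p) = K" and "\<gamma> > 0"
  shows "(\<integral>\<omega>. f ((1 / real K) *\<^sub>R (\<Sum>k<K. rennala_iter G S \<gamma> x0 e \<omega> k)) \<partial>samples) - f xstar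
    \<le> ((norm (xstar - x0))\<^sup>2 + real K * \<gamma>\<^sup>2 * (M\<^sup>2 + \<sigma>\<^sup>2 / real S)) / (2 * \<gamma> * real K)"
    (is "_ \<le> ?B")
proof -
  interpret P: prob_space samples
    by (intro prob_space_PiM prob_space_axioms)
  have "K > 0" using K by simp
  define F where "F \<omega> = f ((1 / real K) *\<^sub>R (\<Sum>k<K. rxs (run \<omega> p) k)) - f xstar" for \<omega>
  have avg: "f ((1 / real K) *\<^sub>R (\<Sum>k<K. rennala_iter G S \<gamma> x0 e \<omega> k)) = F \<omega> + f xstar" for \<omega>
  proof -
    have "rennala_iter G S \<gamma> x0 e \<omega> k = rxs (run \<omega> p) k" if "k < K" for k
      using that K by (intro rennala_iter_eq) (auto simp: rk_run)
    then show ?thesis by (simp add: F_def)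
  qed
  have [measurable]: "F \<in> borel_measurable samples"
    unfolding F_def[abs_def] by measurable
  have F_nonneg: "F \<omega> \<ge> 0" for \<omega>
    by (simp add: F_def min)
  have F_le: "F \<omega> \<le> 1 / (2 * \<gamma> * real K) * lyapunov (run \<omega> p)" for \<omega>
  proof -
    have "f (\<Sum>k<K. (1 / real K) *\<^sub>R rxs (run \<omega> p) k) \<le> (\<Sum>k<K. 1 / real K * f (rxs (run \<omega> p) k))"
      using \<open>K > 0\<close> by (intro convex_on_sum[OF _ _ conv]) auto
    then have "F \<omega> \<le> (\<Sum>k<K. 1 / real K * f (rxs (run \<omega> p) k)) - f xstar"
      by (simp add: F_def scaleR_sum_right)
    also have "\<dots> = 1 / real K * total_gap (run \<omega> p)"
    proof -
      have "total_gap (run \<omega> p) = (\<Sum>k<K. f (rxs (run \<omega> p) k)) - real K * f xstar"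
        using K by (auto simp: total_gap_def rk_run sum_subtractf lessThan_Suc_atMost)
      then show ?thesis
        using \<open>K > 0\<close> by (simp add: field_simps flip: sum_divide_distrib)
    qed
    also have "\<dots> \<le> 1 / (2 * \<gamma> * real K) * lyapunov (run \<omega> p)"
      using \<open>K > 0\<close> \<open>\<gamma> > 0\<close> by (simp add: lyapunov_def field_simps)
    finally show ?thesis .
  qed
  have "budget p \<le> (norm (xstar - x0))\<^sup>2 + real K * \<gamma>\<^sup>2 * (M\<^sup>2 + \<sigma>\<^sup>2 / real S)"
  proof -
    \<comment> \<open>The unfinished last iteration counts as at most one full batch.\<close>
    have "real (iteration p) * real S + real (accepted p) \<le> real K * real S"
      using accepted_less[of p] by (simp add: K[symmetric] algebra_simps)
    then have "(real (iteration p) * real S + real (accepted p)) * ((\<gamma> / real S)\<^sup>2 * \<sigma>\<^sup>2)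
        \<le> real K * real S * ((\<gamma> / real S)\<^sup>2 * \<sigma>\<^sup>2)"
      by (intro mult_right_mono) auto
    also have "\<dots> = real K * \<gamma>\<^sup>2 * (\<sigma>\<^sup>2 / real S)"
      using S_pos by (simp add: field_simps power2_eq_square)
    finally show ?thesis
      by (simp add: budget_def K[symmetric] algebra_simps)
  qed
  then have budget: "1 / (2 * \<gamma> * real K) * budget p \<le> ?B"
    using \<open>K > 0\<close> \<open>\<gamma> > 0\<close> by (simp add: divide_right_mono)
  have "(\<integral>\<^sup>+\<omega>. F \<omega> \<partial>samples) \<le> (\<integral>\<^sup>+\<omega>. ennreal (1 / (2 * \<gamma> * real K)) * ennreal (lyapunov (run \<omega> p)) \<partial>samples)"
    using F_le \<open>\<gamma> > 0\<close>
    by (intro nn_integral_mono, subst ennreal_mult'[symmetric]) (auto intro: ennreal_leI)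
  also have "\<dots> = ennreal (1 / (2 * \<gamma> * real K)) * (\<integral>\<^sup>+\<omega>. lyapunov (run \<omega> p) \<partial>samples)"
    by (intro nn_integral_cmult) (simp add: lyapunov_def)
  also have "\<dots> \<le> ennreal (1 / (2 * \<gamma> * real K)) * ennreal (budget p)"
    by (intro mult_left_mono nn_integral_lyapunov_run_le) auto
  also have "\<dots> = ennreal (1 / (2 * \<gamma> * real K) * budget p)"
    using \<open>\<gamma> > 0\<close> by (intro ennreal_mult'[symmetric]) simp
  also have "\<dots> \<le> ennreal ?B"
    using budget by (rule ennreal_leI)
  finally have F_int: "(\<integral>\<^sup>+\<omega>. F \<omega> \<partial>samples) \<le> ennreal ?B" .
  \<comment> \<open>The finite nonnegative integral yields integrability, so the Bochner integral in
    the claim is a genuine expectation and \<open>f xstar\<close> can be split off.\<close>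
  then have "integrable samples F"
    using F_nonneg by (intro integrableI_nonneg) (auto intro: le_less_trans)
  moreover have "?B \<ge> 0"
    using \<open>\<gamma> > 0\<close> by simp
  then have "(\<integral>\<omega>. F \<omega> \<partial>samples) \<le> ?B"
    using F_int F_nonneg by (subst integral_eq_nn_integral) (auto intro: enn2real_leI)
  ultimately show ?thesis
    unfolding avg by (simp add: P.prob_space)
qed

end

section \<open>Choice of constants and the two final bounds\<close>

theorem mainTheorem9:
  fixes f :: "'a::euclidean_space \<Rightarrow> real"
    and xstar x0 :: 'a
    and M \<sigma> \<epsilon> :: real
    and D :: "'b measure"
    and G :: "'a \<Rightarrow> 'b \<Rightarrow> 'a"
    and n :: nat and \<tau> :: "nat \<Rightarrow> real"
    and e :: "nat \<Rightarrow> nat \<times> nat"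
    and S K :: nat and \<gamma> R :: real
  assumes conv: "convex_on UNIV f"
    and min: "\<forall>x. f xstar \<le> f x"
    and Mpos: "M > 0"
    and lip: "M-lipschitz_on UNIV f"
    and eps: "\<epsilon> > 0"
    and D: "prob_space D"
    and Gmeas: "(\<lambda>(x, \<xi>). G x \<xi>) \<in> borel_measurable (borel \<Otimes>\<^sub>M D)"
    and Gint: "\<forall>x. integrable D (G x)"
    and Gunb: "\<forall>x. (\<integral>\<xi>. G x \<xi> \<partial>D) \<in> subdifferential f x"
    and Gvar_int: "\<forall>x. integrable D (\<lambda>\<xi>. (norm (G x \<xi> - (\<integral>\<zeta>. G x \<zeta> \<partial>D)))\<^sup>2)"
    and Gvar: "\<forall>x. (\<integral>\<xi>. (norm (G x \<xi> - (\<integral>\<zeta>. G x \<zeta> \<partial>D)))\<^sup>2 \<partial>D) \<le> \<sigma>\<^sup>2"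
    and n: "n \<ge> 1"
    and tpos: "\<forall>i<n. 0 < \<tau> i"
    and tsorted: "\<forall>i j. i \<le> j \<and> j < n \<longrightarrow> \<tau> i \<le> \<tau> j"
    and order: "admissible_order n \<tau> e"
    and R: "R = norm (xstar - x0)"
    and S: "S = max (nat \<lceil>\<sigma>\<^sup>2 / M\<^sup>2\<rceil>) 1"
    and \<gamma>: "\<gamma> = \<epsilon> / (M\<^sup>2 + \<sigma>\<^sup>2 / real S)"
    and K: "real K = 2 * M\<^sup>2 * R\<^sup>2 / \<epsilon>\<^sup>2"
    and Kpos: "K > 0"
  shows "(\<forall>\<omega>. \<exists>p. K \<le> rk (rennala_run G S \<gamma> x0 e \<omega> (Suc p)) \<and>
            ev_time \<tau> (e p) \<le>
              8 * (MIN m\<in>{1..n}. inverse ((1 / real m) * (\<Sum>i<m. 1 / \<tau> i)) *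
                     (M\<^sup>2 * R\<^sup>2 / \<epsilon>\<^sup>2 + \<sigma>\<^sup>2 * R\<^sup>2 / (real m * \<epsilon>\<^sup>2))))
       \<and> (\<integral>\<omega>. f ((1 / real K) *\<^sub>R (\<Sum>k<K. rennala_iter G S \<gamma> x0 e \<omega> k))
             \<partial>(PiM UNIV (\<lambda>_. D))) - f xstar \<le> \<epsilon>"
proof (intro conjI allI)
  define A where "A m = (\<Sum>i<m. 1 / \<tau> i)" for m
  \<comment> \<open>The factor 4 suffices because \<open>S + 2 * m\<close> is at most
    \<open>\<sigma>^2 / M^2 + 1 + 2 * m\<close> and \<open>m \<ge> 1\<close>. Times
    \<open>K\<close>, which contributes a factor 2, it gives the 8 of the stated bound.\<close>
  define t where "t m = 4 * (real m + \<sigma>\<^sup>2 / M\<^sup>2) / A m" for m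
  have S_pos: "S > 0" using S by simp
  have S_ge: "\<sigma>\<^sup>2 / M\<^sup>2 \<le> real S" and S_le: "real S \<le> \<sigma>\<^sup>2 / M\<^sup>2 + 1"
  proof -
    have "\<sigma>\<^sup>2 / M\<^sup>2 \<ge> 0" by simp
    then show "\<sigma>\<^sup>2 / M\<^sup>2 \<le> real S" "real S \<le> \<sigma>\<^sup>2 / M\<^sup>2 + 1"
      unfolding S max_def by (auto simp del: zero_le_divide_iff)
  qed
  have A_pos: "A m > 0" if "m \<in> {1..n}" for m
    unfolding A_def using that tpos by (intro sum_pos) (auto simp: lessThan_empty_iff)
  have t_nonneg: "t m \<ge> 0" if "m \<in> {1..n}" for m
    using A_pos[OF that] by (simp add: t_def)
  have t_enough: "real S + 2 * real m \<le> t m * (\<Sum>i<m. 1 / \<tau> i)" if "m \<in> {1..n}" for m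
  proof -
    have "t m * (\<Sum>i<m. 1 / \<tau> i) = 4 * (real m + \<sigma>\<^sup>2 / M\<^sup>2)"
      using A_pos[OF that] by (simp add: t_def flip: A_def)
    moreover have "\<sigma>\<^sup>2 / M\<^sup>2 \<ge> 0" "real m \<ge> 1" using that by auto
    ultimately show ?thesis using S_le by argo
  qed
  have bound_eq: "8 * (inverse ((1 / real m) * (\<Sum>i<m. 1 / \<tau> i)) *
      (M\<^sup>2 * R\<^sup>2 / \<epsilon>\<^sup>2 + \<sigma>\<^sup>2 * R\<^sup>2 / (real m * \<epsilon>\<^sup>2))) = real K * t m" if "m \<in> {1..n}" for m
    using A_pos[OF that] that Mpos eps unfolding K t_def A_def[symmetric]
    by (simp add: field_simps power2_eq_square)
  have timing: "\<exists>p. K \<le> rk (rennala_run G S \<gamma> x0 e \<omega> p) \<and> (\<forall>q<p. ev_time \<tau> (e q) \<le> real K * t m)"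
    if "m \<in> {1..n}" for m \<omega>
    using that t_nonneg t_enough S_pos by (intro iterations_time[OF order tpos]) auto
  show "\<exists>p. K \<le> rk (rennala_run G S \<gamma> x0 e \<omega> (Suc p)) \<and>
            ev_time \<tau> (e p) \<le>
              8 * (MIN m\<in>{1..n}. inverse ((1 / real m) * (\<Sum>i<m. 1 / \<tau> i)) *
                     (M\<^sup>2 * R\<^sup>2 / \<epsilon>\<^sup>2 + \<sigma>\<^sup>2 * R\<^sup>2 / (real m * \<epsilon>\<^sup>2)))" (is "\<exists>p. _ \<and> _ \<le> 8 * Min (?g ` _)")
    for \<omega>
  proof -
    have "Min (?g ` {1..n}) \<in> ?g ` {1..n}"
      using n by (intro Min_in) auto
    then obtain m where m: "m \<in> {1..n}" and min_eq: "Min (?g ` {1..n}) = ?g m"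
      by blast
    obtain p where p: "K \<le> rk (rennala_run G S \<gamma> x0 e \<omega> p)" "\<forall>q<p. ev_time \<tau> (e q) \<le> real K * t m"
      using timing[OF m] by blast
    \<comment> \<open>No iteration is complete before the first arrival, so \<open>K > 0\<close>
      excludes \<open>p = 0\<close> and there is a last processed arrival \<open>p'\<close>.\<close>
    with Kpos obtain p' where "p = Suc p'"
      by (cases p) auto
    with p show ?thesis
      unfolding min_eq bound_eq[OF m] by blast
  qed
  define V where "V = M\<^sup>2 + \<sigma>\<^sup>2 / real S"
  have V_pos: "V > 0"
    using Mpos by (simp add: V_def add_pos_nonneg)
  \<comment> \<open>This is the purpose of the batch size: \<open>S \<ge> \<sigma>^2 / M^2\<close>
    brings \<open>\<sigma>^2 / S\<close> down to at most \<open>M^2\<close>.\<close>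
  have V_le: "V \<le> 2 * M\<^sup>2"
    using S_ge S_pos Mpos by (simp add: V_def field_simps)
  have \<gamma>_V: "\<gamma> = \<epsilon> / V"
    by (simp add: \<gamma> V_def)
  interpret rennala_sgd D f xstar x0 M \<sigma> \<gamma> G e S
    using D min lip Gmeas Gint Gunb Gvar_int Gvar order S_pos V_pos eps
    by (auto simp: rennala_sgd_def rennala_sgd_axioms_def admissible_order_def bij_betw_def \<gamma>_V)
  \<comment> \<open>The average stops at index \<open>K - 1\<close>, so a position inside that
    iteration is wanted; any sample locates it, the control being deterministic.\<close>
  obtain q where "K \<le> rk (run undefined q)"
    using timing[of 1 undefined] n by auto
  then have "K - 1 \<le> rk (run undefined q)"
    by linarith
  then obtain p where "rk (run undefined p) = K - 1"
    using exists_run_at_iteration by blast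
  then have p: "Suc (iteration p) = K"
    using Kpos by (simp add: rk_run)
  \<comment> \<open>The choice of \<open>K\<close> turns the distance term into
    \<open>V * \<epsilon> / (4 * M^2)\<close>, at most \<open>\<epsilon> / 2\<close> by
    \<open>V_le\<close>; the choice of \<open>\<gamma>\<close> turns the other term,
    \<open>\<gamma> * V / 2\<close>, into \<open>\<epsilon> / 2\<close>.\<close>
  have "((norm (xstar - x0))\<^sup>2 + real K * \<gamma>\<^sup>2 * (M\<^sup>2 + \<sigma>\<^sup>2 / real S)) / (2 * \<gamma> * real K) =
      V * \<epsilon> / (4 * M\<^sup>2) + \<epsilon> / 2"
  proof -
    have "(norm (xstar - x0))\<^sup>2 = real K * \<epsilon>\<^sup>2 / (2 * M\<^sup>2)"
      using K Mpos eps by (simp add: R)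
    then show ?thesis
      unfolding V_def[symmetric] \<gamma>_V using Mpos eps V_pos Kpos
      by (simp add: field_simps power2_eq_square)
  qed
  also have "\<dots> \<le> \<epsilon>"
  proof -
    have "V * \<epsilon> \<le> 2 * M\<^sup>2 * \<epsilon>"
      using V_le eps by (intro mult_right_mono) auto
    then show ?thesis
      using Mpos by (simp add: field_simps)
  qed
  finally show "(\<integral>\<omega>. f ((1 / real K) *\<^sub>R (\<Sum>k<K. rennala_iter G S \<gamma> x0 e \<omega> k))
      \<partial>(PiM UNIV (\<lambda>_. D))) - f xstar \<le> \<epsilon>"
    using expected_gap_average_le[OF conv p] eps V_pos by (simp add: \<gamma>_V)
qed

end
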